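(* Let $q\in(0,1)$, let $m$ be a positive integer, and let $f\in C[0,1]$ be $m$ times differentiable at $0$ from the right. Then, for all $\lambda<1+m$, $$M(r;D_{\infty,q}f)=o\big(r^{-\lambda}(-r;q)_{\infty}\big), \quad r \to \infty.$$
   Context: For $a\in\mathbb{C}$ and $0<q<1$, the $q$-Pochhammer symbols are $(a;q)_0=1$, $(a;q)_n=\prod_{j=0}^{n-1}(1-aq^j)$, $(a;q)_\infty=\prod_{j=0}^{\infty}(1-aq^j)$. The limit $q$-Durrmeyer operator is defined for $f\in C[0,1]$ by $(D_{\infty,q}f)(x)=\sum_{k=0}^{\infty} A_{\infty k}(f)\, p_{\infty k}(q;x)$ for $x\in[0,1)$ and $(D_{\infty,q}f)(1)=f(1)$, where $p_{\infty k}(q;x)=\frac{(x;q)_\infty\, x^k}{(q;q)_k}$ and $A_{\infty k}(f)=\frac{q^{-k}}{1-q}\int_0^1 f(t)\,p_{\infty k}(q;qt)\,d_qt$. Here the $q$-integral is $\int_0^a h(t)\,d_qt=(1-q)a\sum_{j=0}^\infty q^j h(aq^j)$. Equivalently, $A_{\infty k}(f)=\frac{(q;q)_\infty}{(q;q)_k}\sum_{j=0}^\infty \frac{f(q^j)q^{(k+1)j}}{(q;q)_j}$. The function $D_{\infty,q}f$ extends (uniquely) from $[0,1]$ to an entire function, still denoted $D_{\infty,q}f$. For a function $h$ analytic in the closed disc $\Delta_r=\{z\in\mathbb{C}:|z|\leqslant r\}$, $M(r;h)=\max_{z\in\Delta_r}|h(z)|$. *)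

theory Defs
  imports "HOL-Complex_Analysis.Complex_Analysis" "HOL-Library.Landau_Symbols"
begin

definition qpoch :: "'a::real_normed_field \<Rightarrow> real \<Rightarrow> nat \<Rightarrow> 'a"
  where "qpoch a q n = (\<Prod>j<n. 1 - a * of_real q ^ j)"

definition qpoch_inf :: "'a::real_normed_field \<Rightarrow> real \<Rightarrow> 'a"
  where "qpoch_inf a q = (\<Prod>j. 1 - a * of_real q ^ j)"

definition q_integral :: "real \<Rightarrow> real \<Rightarrow> (real \<Rightarrow> complex) \<Rightarrow> complex"
  where "q_integral q a h =
    of_real ((1 - q) * a) * (\<Sum>j. of_real (q ^ j) * h (a * q ^ j))"

definition p_inf :: "real \<Rightarrow> nat \<Rightarrow> real \<Rightarrow> real"
  where "p_inf q k x = qpoch_inf x q * x ^ k / qpoch q q k"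

definition A_inf :: "real \<Rightarrow> nat \<Rightarrow> (real \<Rightarrow> complex) \<Rightarrow> complex"
  where "A_inf q k f =
    of_real (inverse (q ^ k) / (1 - q)) *
    q_integral q 1 (\<lambda>t. f t * of_real (p_inf q k (q * t)))"

text \<open>Only the values of the following function on \<open>{0..1}\<close> are meaningful.\<close>

definition limit_q_durrmeyer :: "real \<Rightarrow> (real \<Rightarrow> complex) \<Rightarrow> real \<Rightarrow> complex"
  where "limit_q_durrmeyer q f x =
    (if x = 1 then f 1 else (\<Sum>k. A_inf q k f * of_real (p_inf q k x)))"

text \<open>The unique entire function that agrees with \<open>limit_q_durrmeyer q f\<close> on \<open>{0..1}\<close>.\<close>

definition limit_q_durrmeyer_entire :: "real \<Rightarrow> (real \<Rightarrow> complex) \<Rightarrow> complex \<Rightarrow> complex"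
  where "limit_q_durrmeyer_entire q f =
    (THE F. F holomorphic_on UNIV \<and>
            (\<forall>x\<in>{0..1}. F (of_real x) = limit_q_durrmeyer q f x))"

definition max_modulus :: "real \<Rightarrow> (complex \<Rightarrow> complex) \<Rightarrow> real"
  where "max_modulus r h = (SUP z\<in>cball 0 r. norm (h z))"

text \<open>
  \<open>f\<close> is \<open>m\<close> times differentiable at \<open>a\<close> from the right: for \<open>m > 0\<close>, the derivatives
  \<open>g 1, \<dots>, g (m - 1)\<close> of \<open>f\<close> exist on some \<open>[a, a + \<delta>)\<close> (one-sided at \<open>a\<close>), and the last one
  has a one-sided derivative at \<open>a\<close>. Since \<open>\<delta>\<close> may be decreased, only the
  values of \<open>f\<close> in an arbitrarily small right neighbourhood of \<open>a\<close> matter.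
\<close>

definition times_differentiable_at_right :: "nat \<Rightarrow> (real \<Rightarrow> complex) \<Rightarrow> real \<Rightarrow> bool"
  where "times_differentiable_at_right m f a \<longleftrightarrow>
    (\<exists>\<delta>>0. \<exists>g :: nat \<Rightarrow> real \<Rightarrow> complex. g 0 = f \<and>
       (\<forall>k. Suc k < m \<longrightarrow> (\<forall>x\<in>{a..<a + \<delta>}.
          (g k has_vector_derivative g (Suc k) x) (at x within {a..<a + \<delta>}))) \<and>
       (m > 0 \<longrightarrow> g (m - 1) differentiable (at a within {a..<a + \<delta>})))"

end

(*
Only the values of f at the nodes q^i enter: with
D_l = sum_{i<=l} f(q^i) g_i e_{l-i}, where sum g_n x^n = 1/(x;q)_inf and sum e_n x^n = (x;q)_inf
are Euler's two series, a Cauchy product gives A_k(f) = sum_l D_l q^{(k+1)l}. Interchanging sums in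
the definition of the operator and using Euler's first series once more yields
(D_{inf,q} f)(x) = sum_l D_l q^l (x;q)_l, which converges on the whole plane and is the entire extension.
The functional f -> D_l annihilates polynomials of degree < l, so a Taylor expansion of f at 0 gives
D_l = O(q^{ml}). On |z| <= r one has |(z;q)_l| <= (-r;q)_l = (-r;q)_inf / (-r q^l;q)_inf, and the
denominator is at least c (r q^l)^mu for every mu >= 0; with lambda < mu < m + 1 the series sums to
O(r^{-mu} (-r;q)_inf).
*)
theory Submission
  imports Defs
begin

section \<open>Interchange of two infinite sums\<close>

text \<open>The product bound makes the family absolutely summable over all pairs, so Fubini for
  \<open>infsum\<close> applies. It remains to identify \<open>infsum\<close> with
  \<open>suminf\<close>, which holds wherever the norms are summable: in each row, in each column,
  and for both outer sums.\<close>

lemma suminf_swap_dominated: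
  fixes f :: "nat \<Rightarrow> nat \<Rightarrow> 'a::banach" and u v :: "nat \<Rightarrow> real"
  assumes u: "summable u" "\<And>k. 0 \<le> u k" and v: "summable v" "\<And>l. 0 \<le> v l"
    and le: "\<And>k l. norm (f k l) \<le> u k * v l"
  shows "(\<Sum>k. \<Sum>l. f k l) = (\<Sum>l. \<Sum>k. f k l)"
proof -
  have vs: "(v has_sum suminf v) UNIV"
    using v by (intro norm_summable_imp_has_sum) (auto simp: summable_sums)
  have us: "u summable_on UNIV"
    using u by (intro norm_summable_imp_summable_on) auto
  have prod: "(\<lambda>(k, l). u k * v l) summable_on UNIV \<times> UNIV"
    using u v vs us
    by (intro summable_on_SigmaI[where g = "\<lambda>k. u k * suminf v"])
       (auto intro: has_sum_cmult_right summable_on_cmult_left)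
  have "(\<lambda>p. norm ((\<lambda>(k, l). f k l) p)) summable_on UNIV \<times> UNIV"
    by (rule Infinite_Sum.abs_summable_on_comparison_test'[OF prod]) (use le in auto)
  then have f: "(\<lambda>(k, l). f k l) summable_on UNIV \<times> UNIV"
    by (rule abs_summable_summable)
  have row: "summable (\<lambda>l. norm (f k l))" for k
    by (rule summable_comparison_test'[where g = "\<lambda>l. u k * v l"])
       (use v le in \<open>auto intro: summable_mult\<close>)
  have col: "summable (\<lambda>k. norm (f k l))" for l
    by (rule summable_comparison_test'[where g = "\<lambda>k. u k * v l"])
       (use u le in \<open>auto intro: summable_mult2\<close>)
  have row_inf: "infsum (f k) UNIV = (\<Sum>l. f k l)" for k
    by (rule infsumI, rule norm_summable_imp_has_sum)
       (use row in \<open>auto intro: summable_sums summable_norm_cancel\<close>)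
  have col_inf: "infsum (\<lambda>k. f k l) UNIV = (\<Sum>k. f k l)" for l
    by (rule infsumI, rule norm_summable_imp_has_sum)
       (use col in \<open>auto intro: summable_sums summable_norm_cancel\<close>)
  have row_bound: "norm (\<Sum>l. f k l) \<le> u k * suminf v" for k
  proof -
    have "norm (\<Sum>l. f k l) \<le> (\<Sum>l. norm (f k l))" by (rule summable_norm[OF row])
    also have "\<dots> \<le> (\<Sum>l. u k * v l)"
      by (rule suminf_le[OF le row]) (use v in \<open>auto intro: summable_mult\<close>)
    also have "\<dots> = u k * suminf v" using v by (simp add: suminf_mult)
    finally show ?thesis .
  qed
  have col_bound: "norm (\<Sum>k. f k l) \<le> suminf u * v l" for l
  proof -
    have "norm (\<Sum>k. f k l) \<le> (\<Sum>k. norm (f k l))" by (rule summable_norm[OF col])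
    also have "\<dots> \<le> (\<Sum>k. u k * v l)"
      by (rule suminf_le[OF le col]) (use u in \<open>auto intro: summable_mult2\<close>)
    also have "\<dots> = suminf u * v l" using u by (simp add: suminf_mult2)
    finally show ?thesis .
  qed
  have "summable (\<lambda>k. norm (\<Sum>l. f k l))"
    by (rule summable_comparison_test'[where g = "\<lambda>k. u k * suminf v"])
       (use u row_bound in \<open>auto intro: summable_mult2\<close>)
  then have "infsum (\<lambda>k. infsum (f k) UNIV) UNIV = (\<Sum>k. \<Sum>l. f k l)"
    unfolding row_inf
    by (intro infsumI norm_summable_imp_has_sum) (auto intro: summable_sums summable_norm_cancel)
  moreover have "summable (\<lambda>l. norm (\<Sum>k. f k l))"
    by (rule summable_comparison_test'[where g = "\<lambda>l. suminf u * v l"])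
       (use v col_bound in \<open>auto intro: summable_mult\<close>)
  then have "infsum (\<lambda>l. infsum (\<lambda>k. f k l) UNIV) UNIV = (\<Sum>l. \<Sum>k. f k l)"
    unfolding col_inf
    by (intro infsumI norm_summable_imp_has_sum) (auto intro: summable_sums summable_norm_cancel)
  ultimately show ?thesis using infsum_swap_banach[OF f] by simp
qed

section \<open>One-sided Taylor expansion\<close>

text \<open>Induction down the chain of derivatives: \<open>g (m - Suc j)\<close> is approximated to
  the right of \<open>a\<close> by a polynomial of degree at most j with error O(t^(j+1)). The base
  case is the derivative of \<open>g (m - 1)\<close> at \<open>a\<close>; each further step
  antidifferentiates the polynomial and bounds the error by the mean value inequality, which is
  available for complex values. The case j = m - 1 concerns f itself.\<close>

lemma taylor_right_remainder:
  assumes "times_differentiable_at_right m f a" and "0 < m"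
  shows "\<exists>c C \<delta>. 0 < \<delta> \<and> (\<forall>t\<in>{0..<\<delta>}. norm (f (a + t) - (\<Sum>s<m. c s * of_real t ^ s)) \<le> C * t ^ m)"
proof -
  obtain \<delta> g where \<delta>: "0 < \<delta>" and g0: "g 0 = f"
    and g: "\<And>k x. Suc k < m \<Longrightarrow> x \<in> {a..<a + \<delta>} \<Longrightarrow>
          (g k has_vector_derivative g (Suc k) x) (at x within {a..<a + \<delta>})"
    and gm: "g (m - 1) differentiable (at a within {a..<a + \<delta>})"
    using assms unfolding times_differentiable_at_right_def by blast
  have "\<exists>c C d. 0 < d \<and> d \<le> \<delta> \<and> (\<forall>t\<in>{0..<d}.
      norm (g (m - Suc j) (a + t) - (\<Sum>s<Suc j. c s * of_real t ^ s)) \<le> C * t ^ Suc j)"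
    if "j < m" for j
    using that
  proof (induction j)
    case 0
    obtain D where D: "(g (m - 1) has_vector_derivative D) (at a within {a..<a + \<delta>})"
      using gm vector_derivative_works by blast
    then have "((\<lambda>y. (g (m - 1) y - (g (m - 1) a + (y - a) *\<^sub>R D)) /\<^sub>R norm (y - a)) \<longlongrightarrow> 0)
        (at a within {a..<a + \<delta>})"
      unfolding has_vector_derivative_def has_derivative_within by (auto simp: field_simps)
    \<comment> \<open>Tolerance 1 bounds the linearization error by t, whence the constant
      \<open>1 + norm D\<close> below.\<close>
    from tendstoD[OF this, of 1] obtain e where e: "0 < e" and
      E: "\<And>y. y \<in> {a..<a + \<delta>} \<Longrightarrow> y \<noteq> a \<Longrightarrow> dist y a < e \<Longrightarrow>
         norm ((g (m - 1) y - (g (m - 1) a + (y - a) *\<^sub>R D)) /\<^sub>R norm (y - a)) < 1"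
      unfolding eventually_at by auto
    have "norm (g (m - 1) (a + t) - g (m - 1) a) \<le> (1 + norm D) * t" if t: "t \<in> {0..<min \<delta> e}" for t
    proof (cases "t = 0")
      case False
      then have tp: "0 < t" using t by auto
      have "norm (g (m - 1) (a + t) - (g (m - 1) a + t *\<^sub>R D)) < t"
      proof -
        have "norm ((g (m - 1) (a + t) - (g (m - 1) a + t *\<^sub>R D)) /\<^sub>R t) < 1"
          using E[of "a + t"] tp t by (simp add: dist_norm)
        then show ?thesis using tp by (simp add: divide_simps)
      qed
      moreover have "norm (g (m - 1) (a + t) - g (m - 1) a)
          \<le> norm (g (m - 1) (a + t) - (g (m - 1) a + t *\<^sub>R D)) + norm (t *\<^sub>R D)"
        by (rule order_trans[OF _ norm_triangle_ineq]) simp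
      ultimately show ?thesis using tp by (simp add: algebra_simps)
    qed auto
    then show ?case using \<delta> e
      by (intro exI[of _ "\<lambda>_. g (m - 1) a"] exI[of _ "1 + norm D"] exI[of _ "min \<delta> e"]) auto
  next
    case (Suc j)
    then obtain c C d where d: "0 < d" "d \<le> \<delta>" and
      C: "\<And>t. t \<in> {0..<d} \<Longrightarrow>
        norm (g (m - Suc j) (a + t) - (\<Sum>s<Suc j. c s * of_real t ^ s)) \<le> C * t ^ Suc j"
      using Suc.IH[OF Suc_lessD[OF Suc.prems]] by blast
    define k where "k = m - Suc (Suc j)"
    have k: "Suc k < m" "m - Suc j = Suc k" using Suc.prems by (auto simp: k_def)
    \<comment> \<open>\<open>b\<close> antidifferentiates the polynomial with coefficients
      \<open>c\<close> and has constant term \<open>g k a\<close>; hence \<open>h\<close> vanishes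
      at 0 and has derivative \<open>h'\<close>.\<close>
    define b where "b s = (if s = 0 then g k a else c (s - 1) / of_nat s)" for s
    define h where "h t = g k (a + t) - (\<Sum>s<Suc (Suc j). b s * of_real t ^ s)" for t
    define h' where "h' t = g (Suc k) (a + t) - (\<Sum>s<Suc j. c s * of_real t ^ s)" for t
    have h0: "h 0 = 0" by (simp add: h_def b_def sum.lessThan_Suc_shift del: sum.lessThan_Suc)
    have "norm (h t) \<le> C * t ^ Suc (Suc j)" if t: "t \<in> {0..<d}" for t
    proof -
      have deriv: "(h has_vector_derivative h' x) (at x within {0..t})" if x: "x \<in> {0..t}" for x
      proof -
        have "((\<lambda>t. g k (a + t)) has_vector_derivative g (Suc k) (a + x)) (at x within {0..t})"
        proof -
          have "(g k has_vector_derivative g (Suc k) (a + x)) (at (a + x) within (\<lambda>t. a + t) ` {0..t})"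
            by (rule has_vector_derivative_within_subset[OF g]) (use k x t d in auto)
          moreover have "((\<lambda>t. a + t) has_vector_derivative 1) (at x within {0..t})"
            by (auto intro!: derivative_eq_intros)
          ultimately have "(g k \<circ> (\<lambda>t. a + t) has_vector_derivative (1 *\<^sub>R g (Suc k) (a + x))) (at x within {0..t})"
            by (intro vector_diff_chain_within)
          then show ?thesis by (simp add: o_def)
        qed
        moreover have "((\<lambda>t. \<Sum>s<Suc (Suc j). b s * of_real t ^ s) has_vector_derivative
             (\<Sum>s<Suc j. c s * of_real x ^ s)) (at x within {0..t})"
        proof -
          have "((\<lambda>t. b 0 + (\<Sum>s<Suc j. b (Suc s) * of_real t ^ Suc s)) has_vector_derivative
             (0 + (\<Sum>s<Suc j. c s * of_real x ^ s))) (at x within {0..t})"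
          proof (intro has_vector_derivative_add has_vector_derivative_const has_vector_derivative_sum)
            fix s
            have "((\<lambda>z. b (Suc s) * z ^ Suc s) has_field_derivative c s * of_real x ^ s)
                (at (complex_of_real x))"
              by (rule derivative_eq_intros refl)+ (simp add: b_def field_simps del: of_nat_Suc)
            from has_vector_derivative_real_field[OF this]
            show "((\<lambda>t. b (Suc s) * of_real t ^ Suc s) has_vector_derivative c s * of_real x ^ s)
               (at x within {0..t})" .
          qed
          then show ?thesis
            by (simp only: sum.lessThan_Suc_shift[where n = "Suc j"]) simp
        qed
        ultimately show ?thesis unfolding h_def h'_def by (rule has_vector_derivative_diff)
      qed
      \<comment> \<open>The sign of \<open>C\<close> is not known in advance. The nonnegativity
        required here is read off from the bound itself, used at t when x = 0 and at x
        otherwise.\<close>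
      have B: "norm (h' x) \<le> C * t ^ Suc j" if x: "x \<in> {0..t}" for x
      proof -
        have *: "norm (h' x) \<le> C * x ^ Suc j" using C[of x] x t k by (simp add: h'_def)
        show ?thesis
        proof (cases "x = 0")
          case True
          have "0 \<le> C * t ^ Suc j" using C[of t] t norm_ge_zero order_trans by blast
          then show ?thesis using True * by simp
        next
          case False
          then have "0 \<le> C" using * x
            by (metis atLeastAtMost_iff less_le mult_less_0_iff norm_ge_zero not_le order_less_le_trans zero_less_power)
          then show ?thesis using * x
            by (meson atLeastAtMost_iff mult_left_mono order_trans power_mono)
        qed
      qed
      have "onorm (\<lambda>r. r *\<^sub>R h' x) \<le> C * t ^ Suc j" if "x \<in> {0..t}" for x
        using mult_left_mono[OF B[OF that] abs_ge_zero] by (intro onorm_le) (simp add: mult_ac)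
      then have "norm (h t - h 0) \<le> (C * t ^ Suc j) * norm (t - 0)"
        by (intro differentiable_bound[where S = "{0..t}" and f' = "\<lambda>x r. r *\<^sub>R h' x"])
           (use deriv t in \<open>auto simp: has_vector_derivative_def\<close>)
      then show ?thesis using h0 t by (simp add: algebra_simps)
    qed
    then show ?case
      using d unfolding h_def k_def[symmetric] by blast
  qed
  from this[of "m - 1"] \<open>0 < m\<close> show ?thesis by (auto simp: g0)
qed

section \<open>q-Pochhammer products: splitting, monotonicity and growth\<close>

context
  fixes q :: real
  assumes q: "0 < q" "q < 1"
begin

lemma summable_qpower: "summable (\<lambda>j. norm (a * of_real q ^ j))"
  for a :: "'a::real_normed_field"
  using q by (auto simp: norm_mult norm_power intro!: summable_mult summable_geometric)

lemma convergent_prod_qpoch: "convergent_prod (\<lambda>j. 1 - a * of_real q ^ j)"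
  for a :: "'a::{real_normed_field,banach}"
  by (rule abs_convergent_prod_imp_convergent_prod, subst abs_convergent_prod_conv_summable)
     (use summable_qpower[of a] in simp)

lemma qpoch_tendsto: "qpoch a q \<longlonglongrightarrow> qpoch_inf a q"
  for a :: "'a::{real_normed_field,banach}"
  using convergent_prod_LIMSEQ[OF convergent_prod_qpoch[of a]]
  unfolding qpoch_def[abs_def] qpoch_inf_def by (simp add: LIMSEQ_lessThan_iff_atMost)

lemma qpoch_0 [simp]: "qpoch a q 0 = 1"
  and qpoch_Suc: "qpoch a q (Suc n) = qpoch a q n * (1 - a * of_real q ^ n)"
  by (simp_all add: qpoch_def)

lemma qpoch_add: "qpoch a q (l + n) = qpoch a q l * qpoch (a * of_real q ^ l) q n"
  by (induction n) (simp_all add: qpoch_Suc power_add mult.assoc)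

lemma qpoch_inf_split: "qpoch_inf a q = qpoch a q l * qpoch_inf (a * of_real q ^ l) q"
  for a :: "'a::{real_normed_field,banach}"
proof -
  have "(\<lambda>n. qpoch a q (l + n)) \<longlonglongrightarrow> qpoch a q l * qpoch_inf (a * of_real q ^ l) q"
    unfolding qpoch_add by (intro tendsto_intros qpoch_tendsto)
  moreover have "(\<lambda>n. qpoch a q (l + n)) \<longlonglongrightarrow> qpoch_inf a q"
    using LIMSEQ_ignore_initial_segment[OF qpoch_tendsto[of a], of l] by (simp add: add.commute)
  ultimately show ?thesis by (rule LIMSEQ_unique[rotated])
qed

lemma qpoch_q_pos: "0 < qpoch q q n"
proof (induction n)
  case (Suc n)
  have "q * q ^ n < 1" using q power_Suc_less_one[of q n] by simp
  with Suc show ?case by (simp add: qpoch_Suc)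
qed simp

lemma qpoch_neg_ge_1: "1 \<le> qpoch (- r) q n" if "0 \<le> r" for r :: real
  unfolding qpoch_def using that q by (intro prod_ge_1) auto

text \<open>By the triangle inequality each factor is dominated on the disc of radius r by its value
  at -r.\<close>

lemma norm_qpoch_le: "norm (qpoch z q n) \<le> qpoch (- r) q n" if "norm z \<le> r"
proof -
  have "norm (1 - z * of_real q ^ j) \<le> 1 + r * q ^ j" for j
  proof -
    have "norm (1 - z * of_real q ^ j) \<le> 1 + norm z * q ^ j"
      using norm_triangle_ineq4[of 1 "z * of_real q ^ j"] q by (simp add: norm_mult norm_power)
    also have "\<dots> \<le> 1 + r * q ^ j" using that q by (simp add: mult_right_mono)
    finally show ?thesis .
  qed
  then show ?thesis
    unfolding qpoch_def by (simp add: prod_norm[symmetric] prod_mono)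
qed

lemma qpoch_neg_le_qpoch_inf: "qpoch (- r) q n \<le> qpoch_inf (- r) q" if "0 \<le> r" for r :: real
proof (rule incseq_le[OF incseq_SucI qpoch_tendsto])
  fix n
  show "qpoch (- r) q n \<le> qpoch (- r) q (Suc n)"
    using qpoch_neg_ge_1[OF that, of n] that q
    by (simp add: qpoch_Suc mult_le_cancel_left1)
qed

lemma qpoch_inf_neg_ge_1: "1 \<le> qpoch_inf (- r) q" if "0 \<le> r" for r :: real
  using qpoch_neg_le_qpoch_inf[OF that, of 0] by simp

text \<open>Already the first \<open>n \<ge> \<mu>\<close> factors of \<open>(-s;q)\<^sub>\<infinity>\<close> grow like \<open>s\<^sup>n\<close>.\<close>

lemma qpoch_inf_neg_ge_powr:
  fixes \<mu> :: real
  assumes "0 \<le> \<mu>"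
  shows "\<exists>c>0. \<forall>s>0. c * s powr \<mu> \<le> qpoch_inf (- s) q"
proof -
  define n where "n = nat \<lceil>\<mu>\<rceil>"
  have n: "\<mu> \<le> real n" unfolding n_def by linarith
  define c where "c = (\<Prod>j<n. q ^ j)"
  have c: "0 < c" "c \<le> 1" using q by (auto simp: c_def power_le_one intro!: prod_pos prod_le_1)
  have "c * s powr \<mu> \<le> qpoch_inf (- s) q" if s: "0 < s" for s
  \<comment> \<open>For s <= 1 the left side is at most 1 and the product at least 1; for s > 1 the
    exponent may be rounded up to n.\<close>
  proof (cases "s \<le> 1")
    case True
    then have "s powr \<mu> \<le> 1" using s assms by (simp add: powr_le1)
    then have "c * s powr \<mu> \<le> 1" using c by (simp add: mult_le_one)
    then show ?thesis using qpoch_inf_neg_ge_1[of s] s by linarith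
  next
    case False
    then have "s powr \<mu> \<le> s ^ n" using n s by (simp add: powr_mono flip: powr_realpow)
    then have "c * s powr \<mu> \<le> c * s ^ n" using c by simp
    also have "\<dots> = (\<Prod>j<n. s * q ^ j)" by (simp add: c_def prod.distrib)
    also have "\<dots> \<le> qpoch (- s) q n" unfolding qpoch_def using s q by (intro prod_mono) auto
    also have "\<dots> \<le> qpoch_inf (- s) q" using s by (intro qpoch_neg_le_qpoch_inf) auto
    finally show ?thesis .
  qed
  then show ?thesis using c by blast
qed

section \<open>Euler's two power series\<close>

text \<open>The coefficient of x^n in 1/(x;q)_inf, called g_n in the overview.\<close>

definition qexp_coeff :: "nat \<Rightarrow> real"
  where "qexp_coeff n = 1 / qpoch q q n"

text \<open>The coefficient of x^n in (x;q)_inf, called e_n in the overview.\<close>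

definition qprod_coeff :: "nat \<Rightarrow> real"
  where "qprod_coeff n = (- 1) ^ n * q ^ (n choose 2) / qpoch q q n"

lemma qexp_coeff_0 [simp]: "qexp_coeff 0 = 1" and qprod_coeff_0 [simp]: "qprod_coeff 0 = 1"
  by (simp_all add: qexp_coeff_def qprod_coeff_def binomial_eq_0)

lemma qexp_coeff_pos: "0 < qexp_coeff n"
  using qpoch_q_pos[of n] by (simp add: qexp_coeff_def)

text \<open>Coefficient form of the functional equation E(xq) = (1 - x) E(x); the next lemma is that
  of E(x) = (1 - x) E(xq).\<close>

lemma qexp_coeff_rec: "(1 - q ^ Suc n) * qexp_coeff (Suc n) = qexp_coeff n"
  using qpoch_q_pos[of "Suc n"] qpoch_q_pos[of n]
  by (auto simp: qexp_coeff_def qpoch_Suc)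

lemma qprod_coeff_rec: "(1 - q ^ Suc n) * qprod_coeff (Suc n) = - (q ^ n * qprod_coeff n)"
proof -
  have "Suc n choose 2 = n + (n choose 2)" by (simp add: numeral_2_eq_2)
  then show ?thesis using qpoch_q_pos[of "Suc n"] qpoch_q_pos[of n]
    by (auto simp: qprod_coeff_def qpoch_Suc power_add)
qed

text \<open>The finite products decrease to (q;q)_inf, which is positive because a convergent
  product without zero factors is nonzero. Its reciprocal is the bound.\<close>

lemma qexp_coeff_bounded: "\<exists>G>0. \<forall>n. qexp_coeff n \<le> G"
proof -
  have "qpoch_inf q q \<noteq> 0"
    unfolding qpoch_inf_def
  proof (rule prodinf_nonzero)
    show "convergent_prod (\<lambda>j. 1 - q * of_real q ^ j)" by (rule convergent_prod_qpoch)
    show "1 - q * of_real q ^ j \<noteq> 0" for j using q power_Suc_less_one[of q j] by simp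
  qed
  moreover have "0 \<le> qpoch_inf q q"
    by (rule LIMSEQ_le_const[OF qpoch_tendsto]) (use qpoch_q_pos less_imp_le in blast)
  moreover have "qpoch_inf q q \<le> qpoch q q n" for n
  proof (rule decseq_ge[OF decseq_SucI qpoch_tendsto])
    fix n show "qpoch q q (Suc n) \<le> qpoch q q n"
      using qpoch_q_pos[of n] q by (simp add: qpoch_Suc mult_le_cancel_left2)
  qed
  ultimately show ?thesis
    by (intro exI[of _ "1 / qpoch_inf q q"]) (auto simp: qexp_coeff_def intro!: divide_left_mono mult_pos_pos qpoch_q_pos)
qed

lemma summable_qexp_series: "summable (\<lambda>n. norm (qexp_coeff n * x ^ n))" if "\<bar>x\<bar> < 1" for x :: real
proof -
  obtain G where "\<And>n. qexp_coeff n \<le> G" using qexp_coeff_bounded by blast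
  then have "norm (norm (qexp_coeff n * x ^ n)) \<le> G * \<bar>x\<bar> ^ n" for n
    using qexp_coeff_pos[of n] by (simp add: abs_mult power_abs mult_right_mono)
  moreover have "summable (\<lambda>n. G * \<bar>x\<bar> ^ n)"
    using that by (intro summable_mult summable_geometric) simp
  ultimately show ?thesis by (rule summable_comparison_test'[rotated])
qed

text \<open>Ratio test: by the recurrence, consecutive terms have ratio |x| q^n / (1 - q^(n+1)) in
  modulus, which tends to 0 for every x.\<close>

lemma summable_qprod_series: "summable (\<lambda>n. norm (qprod_coeff n * x ^ n))" for x :: real
proof -
  \<comment> \<open>Replacing 1 - q^(n+1) by its lower bound 1 - q gives a simpler majorant of the
    ratio from which \<open>N\<close> is chosen.\<close>
  have "(\<lambda>n. q ^ n * (\<bar>x\<bar> / (1 - q))) \<longlonglongrightarrow> 0 * (\<bar>x\<bar> / (1 - q))"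
    by (intro tendsto_intros LIMSEQ_power_zero) (use q in auto)
  then have "eventually (\<lambda>n. q ^ n * (\<bar>x\<bar> / (1 - q)) < 1/2) sequentially"
    by (intro order_tendstoD) auto
  then obtain N where N: "\<And>n. N \<le> n \<Longrightarrow> q ^ n * (\<bar>x\<bar> / (1 - q)) < 1/2"
    by (auto simp: eventually_sequentially)
  show ?thesis
  proof (rule summable_ratio_test[where c = "1/2" and N = N])
    fix n assume n: "N \<le> n"
    have qn: "q ^ Suc n \<le> q" using q mult_left_le[of "q ^ n" q] by (simp add: power_le_one)
    then have qn': "0 < 1 - q ^ Suc n" using q by linarith
    have e: "qprod_coeff (Suc n) = - (q ^ n * qprod_coeff n) / (1 - q ^ Suc n)"
      using qprod_coeff_rec[of n] qn' by (metis less_numeral_extra(3) mult.commute nonzero_eq_divide_eq)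
    have "norm (qprod_coeff (Suc n) * x ^ Suc n)
        = (q ^ n * (\<bar>x\<bar> / (1 - q ^ Suc n))) * norm (qprod_coeff n * x ^ n)"
      unfolding e using qn' q by (simp add: abs_mult power_abs)
    moreover have "q ^ n * (\<bar>x\<bar> / (1 - q ^ Suc n)) \<le> q ^ n * (\<bar>x\<bar> / (1 - q))"
      using q qn qn' by (intro mult_left_mono divide_left_mono mult_pos_pos) auto
    then have "q ^ n * (\<bar>x\<bar> / (1 - q ^ Suc n)) \<le> 1/2" using N[OF n] by linarith
    ultimately have "norm (qprod_coeff (Suc n) * x ^ Suc n) \<le> 1/2 * norm (qprod_coeff n * x ^ n)"
      by (metis mult_right_mono norm_ge_zero)
    then show "norm (norm (qprod_coeff (Suc n) * x ^ Suc n)) \<le> 1/2 * norm (norm (qprod_coeff n * x ^ n))"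
      by simp
  qed simp
qed

text \<open>Continuity of a power series at 0. This supplies the limiting factor when a functional
  equation relating x and xq is iterated.\<close>

lemma q_functional_equation_limit:
  fixes a :: "nat \<Rightarrow> real"
  assumes "a 0 = 1" and R: "0 < R" and sm: "\<And>x. \<bar>x\<bar> < R \<Longrightarrow> summable (\<lambda>n. norm (a n * x ^ n))"
    and x: "\<bar>x\<bar> < R"
  shows "(\<lambda>n. \<Sum>k. a k * (x * q ^ n) ^ k) \<longlonglongrightarrow> 1"
proof -
  have "isCont (\<lambda>x. \<Sum>k. a k * x ^ k) 0"
    by (rule isCont_powser[where K = "R/2"])
       (use sm[of "R/2"] R in \<open>auto intro: summable_norm_cancel\<close>)
  moreover have "(\<lambda>n. x * q ^ n) \<longlonglongrightarrow> x * 0"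
    by (intro tendsto_intros LIMSEQ_power_zero) (use q in auto)
  ultimately have "(\<lambda>n. \<Sum>k. a k * (x * q ^ n) ^ k) \<longlonglongrightarrow> (\<Sum>k. a k * 0 ^ k)"
    by (intro isCont_tendsto_compose[where g = "\<lambda>x. \<Sum>k. a k * x ^ k"]) auto
  then show ?thesis using powser_zero[of a] assms(1) by simp
qed

text \<open>The series satisfies E(x) = (1 - x) E(xq). Iterating gives E(x) = (x;q)_n E(x q^n), and
  n tends to infinity.\<close>

lemma euler_qprod_series: "(\<Sum>n. qprod_coeff n * x ^ n) = qpoch_inf x q" for x :: real
proof -
  define E where "E x = (\<Sum>n. qprod_coeff n * x ^ n)" for x
  have s: "summable (\<lambda>n. qprod_coeff n * x ^ n)" for x
    using summable_qprod_series[of x] by (rule summable_norm_cancel)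
  have rec: "E x = (1 - x) * E (x * q)" for x
  proof -
    have "E x - E (x * q) = (\<Sum>n. (1 - q ^ n) * qprod_coeff n * x ^ n)"
      unfolding E_def using suminf_diff[OF s[of x] s[of "x * q"]]
      by (simp add: power_mult_distrib algebra_simps)
    also have "\<dots> = (\<Sum>n. (1 - q ^ Suc n) * qprod_coeff (Suc n) * x ^ Suc n)"
    proof -
      have "summable (\<lambda>n. (1 - q ^ n) * qprod_coeff n * x ^ n)"
        using summable_diff[OF s[of x] s[of "x * q"]] by (simp add: power_mult_distrib algebra_simps)
      \<comment> \<open>The split-off term n = 0 vanishes, since 1 - q^0 = 0.\<close>
      from suminf_split_head[OF this] show ?thesis by simp
    qed
    also have "\<dots> = (\<Sum>n. - x * (qprod_coeff n * (x * q) ^ n))"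
      unfolding qprod_coeff_rec by (simp add: power_mult_distrib mult_ac)
    also have "\<dots> = - x * E (x * q)" unfolding E_def by (rule suminf_mult[OF s])
    finally show ?thesis by (simp add: algebra_simps)
  qed
  have it: "E x = qpoch x q n * E (x * q ^ n)" for n
  proof (induction n)
    case (Suc n)
    then show ?case using rec[of "x * q ^ n"] by (simp add: qpoch_Suc mult_ac)
  qed simp
  have "(\<lambda>n. qpoch x q n * E (x * q ^ n)) \<longlonglongrightarrow> qpoch_inf x q * 1"
    unfolding E_def
    by (intro tendsto_mult qpoch_tendsto q_functional_equation_limit[where R = "\<bar>x\<bar> + 1"])
       (use summable_qprod_series in auto)
  then show ?thesis using it LIMSEQ_unique[of "\<lambda>_. E x"] by (simp add: E_def)
qed

text \<open>The same iteration with E(xq) = (1 - x) E(x), now inside the unit disc of convergence.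
  The product form also shows that (x;q)_inf is nonzero there.\<close>

lemma euler_qexp_series: "qpoch_inf x q * (\<Sum>n. qexp_coeff n * x ^ n) = 1" if x: "\<bar>x\<bar> < 1" for x :: real
proof -
  define E where "E x = (\<Sum>n. qexp_coeff n * x ^ n)" for x
  have s: "summable (\<lambda>n. qexp_coeff n * x ^ n)" if "\<bar>x\<bar> < 1" for x
    using summable_qexp_series[OF that] by (rule summable_norm_cancel)
  have small: "\<bar>x * q ^ n\<bar> < 1" if "\<bar>x\<bar> < 1" for x n
  proof -
    have "\<bar>x\<bar> * q ^ n \<le> \<bar>x\<bar>" using q by (simp add: mult_le_cancel_left1 mult_left_le power_le_one)
    then show ?thesis using that q by (simp add: abs_mult)
  qed
  have rec: "E (x * q) = (1 - x) * E x" if x: "\<bar>x\<bar> < 1" for x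
  proof -
    note s = s[OF x] s[OF small[OF x, of 1, simplified]]
    have "E x - E (x * q) = (\<Sum>n. (1 - q ^ n) * qexp_coeff n * x ^ n)"
      unfolding E_def using suminf_diff[OF s]
      by (simp add: power_mult_distrib algebra_simps)
    also have "\<dots> = (\<Sum>n. (1 - q ^ Suc n) * qexp_coeff (Suc n) * x ^ Suc n)"
    proof -
      have "summable (\<lambda>n. (1 - q ^ n) * qexp_coeff n * x ^ n)"
        using summable_diff[OF s] by (simp add: power_mult_distrib algebra_simps)
      from suminf_split_head[OF this] show ?thesis by simp
    qed
    also have "\<dots> = (\<Sum>n. x * (qexp_coeff n * x ^ n))"
      unfolding qexp_coeff_rec by (simp add: mult_ac)
    also have "\<dots> = x * E x" unfolding E_def by (rule suminf_mult[OF s(1)])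
    finally show ?thesis by (simp add: algebra_simps)
  qed
  have it: "E (x * q ^ n) = qpoch x q n * E x" for n
  proof (induction n)
    case (Suc n)
    then show ?case using rec[OF small[OF x], of n] by (simp add: qpoch_Suc mult_ac)
  qed simp
  have "(\<lambda>n. E (x * q ^ n)) \<longlonglongrightarrow> 1"
    unfolding E_def
    by (intro q_functional_equation_limit[where R = 1]) (use summable_qexp_series x in auto)
  moreover have "(\<lambda>n. E (x * q ^ n)) \<longlonglongrightarrow> qpoch_inf x q * E x"
    unfolding it by (intro tendsto_intros qpoch_tendsto)
  ultimately show ?thesis unfolding E_def by (rule LIMSEQ_unique[rotated])
qed

section \<open>The coefficients D_l: annihilation of polynomials and decay\<close>

text \<open>The functional D_l of the overview. It equals (-1)^l q^(l choose 2) times the divided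
  difference of f at the nodes 1, q, ..., q^l.\<close>

definition durr_coeff :: "(real \<Rightarrow> complex) \<Rightarrow> nat \<Rightarrow> complex"
  where "durr_coeff f l = (\<Sum>i\<le>l. f (q ^ i) * of_real (qexp_coeff i * qprod_coeff (l - i)))"

lemma durr_coeff_diff: "durr_coeff (\<lambda>t. f t - g t) l = durr_coeff f l - durr_coeff g l"
  by (simp add: durr_coeff_def algebra_simps sum_subtractf)

lemma durr_coeff_sum: "durr_coeff (\<lambda>t. \<Sum>s\<in>S. c s * f s t) l = (\<Sum>s\<in>S. c s * durr_coeff (f s) l)"
  unfolding durr_coeff_def sum_distrib_left sum_distrib_right
  by (subst sum.swap) (simp add: mult.assoc)

text \<open>Write q^i = 1 - (1 - q^i) in the i-th term. The factor 1 - q^i turns g_i into g_(i-1)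
  and removes i = 0; reindexing then moves each node q^i to q^(i+1), which produces the factor
  q^s.\<close>

lemma durr_coeff_power_Suc:
  "durr_coeff (\<lambda>t. of_real t ^ Suc s) (Suc l)
    = durr_coeff (\<lambda>t. of_real t ^ s) (Suc l) - of_real q ^ s * durr_coeff (\<lambda>t. of_real t ^ s) l"
proof -
  have "durr_coeff (\<lambda>t. of_real t ^ s) (Suc l) - durr_coeff (\<lambda>t. of_real t ^ Suc s) (Suc l)
     = (\<Sum>i\<le>Suc l. of_real (q ^ i) ^ s *
         of_real ((1 - q ^ i) * qexp_coeff i * qprod_coeff (Suc l - i)))"
    unfolding durr_coeff_def sum_subtractf[symmetric] by (simp add: algebra_simps)
  also have "\<dots> = (\<Sum>i\<le>l. of_real (q ^ Suc i) ^ s *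
         of_real ((1 - q ^ Suc i) * qexp_coeff (Suc i) * qprod_coeff (l - i)))"
    by (subst sum.atMost_Suc_shift) simp
  also have "\<dots> = of_real q ^ s * durr_coeff (\<lambda>t. of_real t ^ s) l"
    unfolding qexp_coeff_rec durr_coeff_def sum_distrib_left by (simp add: power_mult_distrib mult_ac)
  finally show ?thesis by (simp add: algebra_simps)
qed

text \<open>\<open>p l\<close> is the coefficient of x^l in the product of the two Euler series,
  which is 1. Algebraically, 1 - q^(l+1) = (1 - q^i) + q^i (1 - q^(l+1-i)) and the two coefficient
  recurrences relate \<open>p (Suc l)\<close> to \<open>p l\<close> with factor 1 - q^l, which is 0
  at l = 0.\<close>

lemma durr_coeff_one: "durr_coeff (\<lambda>t. 1) (Suc l) = 0"
proof -
  define p where "p l = (\<Sum>i\<le>l. qexp_coeff i * qprod_coeff (l - i))" for l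
  have rec: "(1 - q ^ Suc l) * p (Suc l) = (1 - q ^ l) * p l" for l
  proof -
    have "(1 - q ^ Suc l) * p (Suc l) = (\<Sum>i\<le>Suc l. (1 - q ^ i) * qexp_coeff i * qprod_coeff (Suc l - i))
       + (\<Sum>i\<le>Suc l. q ^ i * qexp_coeff i * ((1 - q ^ (Suc l - i)) * qprod_coeff (Suc l - i)))"
      (is "_ = ?A + ?B")
    proof -
      have "(1 - q ^ Suc l) * (qexp_coeff i * qprod_coeff (Suc l - i))
         = (1 - q ^ i) * qexp_coeff i * qprod_coeff (Suc l - i)
           + q ^ i * qexp_coeff i * ((1 - q ^ (Suc l - i)) * qprod_coeff (Suc l - i))"
        if "i \<le> Suc l" for i
      proof -
        have "q ^ Suc l = q ^ i * q ^ (Suc l - i)" using that by (simp flip: power_add)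
        then show ?thesis by (simp only:) (simp add: algebra_simps)
      qed
      then show ?thesis
        unfolding p_def sum_distrib_left sum.distrib[symmetric] by (intro sum.cong) auto
    qed
    also have "?A = (\<Sum>i\<le>l. (1 - q ^ Suc i) * qexp_coeff (Suc i) * qprod_coeff (l - i))"
      by (subst sum.atMost_Suc_shift) simp
    also have "\<dots> = p l" unfolding qexp_coeff_rec p_def ..
    \<comment> \<open>The term i = l + 1 drops out because its factor 1 - q^0 is 0.\<close>
    also have "?B = (\<Sum>i\<le>l. q ^ i * qexp_coeff i * ((1 - q ^ Suc (l - i)) * qprod_coeff (Suc (l - i))))"
      by (simp add: Suc_diff_le)
    also have "\<dots> = - (q ^ l * p l)"
      unfolding qprod_coeff_rec p_def sum_distrib_left sum_negf[symmetric]
    proof (intro sum.cong refl)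
      fix i assume "i \<in> {..l}"
      then have "q ^ l = q ^ i * q ^ (l - i)" by (simp flip: power_add)
      then show "q ^ i * qexp_coeff i * - (q ^ (l - i) * qprod_coeff (l - i))
          = - (q ^ l * (qexp_coeff i * qprod_coeff (l - i)))" by simp
    qed
    finally show ?thesis by (simp add: algebra_simps)
  qed
  have pos: "1 - q ^ Suc l \<noteq> 0" for l using q power_Suc_less_one[of q l] by simp
  have "p (Suc l) = 0" for l
  proof (induction l)
    case 0
    then show ?case using rec[of 0] pos[of 0] by simp
  next
    case (Suc l)
    then show ?case using rec[of "Suc l"] pos[of "Suc l"] by (metis mult_eq_0_iff)
  qed
  moreover have "durr_coeff (\<lambda>t. 1) (Suc l) = of_real (p (Suc l))"
    by (simp only: durr_coeff_def p_def of_real_sum mult_1)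
  ultimately show ?thesis by simp
qed

text \<open>The recurrence reduces the pair (s+1, l'+1) to (s, l'+1) and (s, l'), so the induction
  on s must cover all l at once.\<close>

lemma durr_coeff_power_eq_0: "s < l \<Longrightarrow> durr_coeff (\<lambda>t. of_real t ^ s) l = 0"
proof (induction s arbitrary: l)
  case 0
  then show ?case using durr_coeff_one[of "l - 1"] by simp
next
  case (Suc s)
  then obtain l' where l': "l = Suc l'" "s < l'" by (metis Suc_lessE)
  then have "durr_coeff (\<lambda>t. of_real t ^ s) l = 0" "durr_coeff (\<lambda>t. of_real t ^ s) l' = 0"
    using Suc.IH by auto
  then show ?case unfolding l' durr_coeff_power_Suc by simp
qed

lemma durr_coeff_decay_of_flat:
  assumes "\<And>i. norm (f (q ^ i)) \<le> B * q ^ (m * i)"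
  shows "\<exists>C. \<forall>l. norm (durr_coeff f l) \<le> C * q ^ (m * l)"
proof -
  obtain G where G: "0 < G" "\<And>n. qexp_coeff n \<le> G" using qexp_coeff_bounded by blast
  have B: "0 \<le> B" using order_trans[OF norm_ge_zero assms[of 0]] by simp
  \<comment> \<open>Since q^(m i) = q^(m l) q^(-m (l-i)), passing from decay in i to decay in l
    costs q^(-m (l-i)). The coefficients e_(l-i) absorb this loss because Euler's second series
    converges even at q^(-m).\<close>
  define e where "e n = norm (qprod_coeff n * (1 / q ^ m) ^ n)" for n
  have e: "summable e" unfolding e_def by (rule summable_qprod_series)
  have "norm (durr_coeff f l) \<le> (B * G * suminf e) * q ^ (m * l)" for l
  proof -
    have "norm (f (q ^ i) * of_real (qexp_coeff i * qprod_coeff (l - i))) \<le> B * G * e (l - i) * q ^ (m * l)"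
      if "i \<le> l" for i
    proof -
      have "norm (f (q ^ i) * of_real (qexp_coeff i * qprod_coeff (l - i)))
          = norm (f (q ^ i)) * qexp_coeff i * \<bar>qprod_coeff (l - i)\<bar>"
        using qexp_coeff_pos[of i] by (simp add: norm_mult abs_mult)
      also have "\<dots> \<le> (B * q ^ (m * i)) * G * \<bar>qprod_coeff (l - i)\<bar>"
        using assms[of i] G qexp_coeff_pos[of i] B q
        by (intro mult_mono mult_nonneg_nonneg) (auto intro: less_imp_le)
      also have "\<dots> = B * G * e (l - i) * q ^ (m * l)"
      proof -
        have "q ^ (m * l) = q ^ (m * i) * (q ^ m) ^ (l - i)"
          using that by (simp flip: power_mult power_add add: distrib_left[symmetric])
        then show ?thesis using q by (simp add: e_def abs_mult power_abs power_divide)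
      qed
      finally show ?thesis .
    qed
    then have "norm (durr_coeff f l) \<le> (\<Sum>i\<le>l. B * G * e (l - i) * q ^ (m * l))"
      unfolding durr_coeff_def by (intro sum_norm_le) auto
    also have "\<dots> = B * G * q ^ (m * l) * (\<Sum>i\<le>l. e (l - i))"
      by (simp add: sum_distrib_left mult_ac)
    also have "(\<Sum>i\<le>l. e (l - i)) = (\<Sum>i\<le>l. e i)"
      by (rule sum.nat_diff_reindex[of e "Suc l", unfolded lessThan_Suc_atMost, simplified])
    also have "B * G * q ^ (m * l) * (\<Sum>i\<le>l. e i) \<le> B * G * q ^ (m * l) * suminf e"
      using B G q by (intro mult_left_mono sum_le_suminf[OF e]) (auto simp: e_def)
    finally show ?thesis by (simp add: mult_ac)
  qed
  then show ?thesis by blast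
qed

lemma durr_coeff_bounded:
  assumes "\<And>i. norm (f (q ^ i)) \<le> B"
  shows "\<exists>C. \<forall>l. norm (durr_coeff f l) \<le> C"
  using durr_coeff_decay_of_flat[of f B 0] assms by simp

section \<open>Series representation of the operator and its entire extension\<close>

text \<open>With y = q^(k+1), the q-integral becomes (y;q)_inf times the sum of f(q^j) g_j y^j.
  Expanding (y;q)_inf by Euler's second series and forming the Cauchy product collects the
  coefficient D_l of y^l.\<close>

lemma A_inf_eq_suminf:
  assumes B: "\<And>i. norm (f (q ^ i)) \<le> B"
  shows "A_inf q k f = (\<Sum>l. durr_coeff f l * of_real ((q ^ Suc k) ^ l))"
proof -
  define y where "y = q ^ Suc k"
  define c where "c = qpoch_inf y q"
  have y: "0 < y" "y < 1" using q power_Suc_less_one[of q k] by (auto simp: y_def)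
  define a where "a j = f (q ^ j) * of_real (qexp_coeff j * y ^ j)" for j
  define b where "b j = complex_of_real (qprod_coeff j * y ^ j)" for j
  have a: "summable (\<lambda>j. norm (a j))"
  proof (rule summable_comparison_test')
    show "summable (\<lambda>j. B * norm (qexp_coeff j * y ^ j))"
      using y by (intro summable_mult summable_qexp_series) auto
    show "norm (norm (a j)) \<le> B * norm (qexp_coeff j * y ^ j)" for j
      using mult_right_mono[OF B[of j] abs_ge_zero[of "qexp_coeff j * y ^ j"]]
      unfolding a_def by (simp add: norm_mult norm_power abs_mult power_abs)
  qed
  have b: "summable (\<lambda>j. norm (b j))"
    using summable_qprod_series[of y] by (simp only: b_def norm_of_real real_norm_def)
  have sb: "suminf b = of_real c"
    unfolding b_def c_def euler_qprod_series[symmetric]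
    by (rule suminf_of_real[symmetric, OF summable_norm_cancel[OF summable_qprod_series]])
  \<comment> \<open>(q;q)_inf is split twice: after j factors, which gives g_j, and after k factors,
    which cancels the denominator (q;q)_k and leaves \<open>c\<close>.\<close>
  have "p_inf q k (q * q ^ j) = q ^ k * c * qexp_coeff j * (q ^ k) ^ j" for j
  proof -
    have "qpoch_inf (q * q ^ j) q = qexp_coeff j * qpoch_inf q q"
      using qpoch_inf_split[of q j] qpoch_q_pos[of j] by (simp add: qexp_coeff_def)
    moreover have "qpoch_inf q q = qpoch q q k * c"
      using qpoch_inf_split[of q k] by (simp add: c_def y_def)
    ultimately show ?thesis
      using qpoch_q_pos[of k]
      by (simp add: p_inf_def power_mult_distrib flip: power_mult) (simp add: mult_ac)
  qed
  then have "of_real (q ^ j) * (f (1 * q ^ j) * of_real (p_inf q k (q * (1 * q ^ j))))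
      = of_real (q ^ k * c) * a j" for j
    by (simp add: a_def y_def power_mult_distrib mult_ac)
  then have "q_integral q 1 (\<lambda>t. f t * of_real (p_inf q k (q * t)))
      = of_real (1 - q) * (\<Sum>j. of_real (q ^ k * c) * a j)"
    by (simp only: q_integral_def mult_1_right)
  also have "\<dots> = of_real ((1 - q) * q ^ k) * (suminf a * suminf b)"
    using suminf_mult[OF summable_norm_cancel[OF a], of "of_real (q ^ k * c)"]
    by (simp add: sb mult_ac)
  finally have "A_inf q k f = suminf a * suminf b"
    using q unfolding A_inf_def by (simp add: field_simps)
  also have "\<dots> = (\<Sum>l. \<Sum>i\<le>l. a i * b (l - i))" by (rule Cauchy_product[OF a b])
  also have "\<dots> = (\<Sum>l. durr_coeff f l * of_real (y ^ l))"
  proof (rule suminf_cong)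
    fix l
    have "a i * b (l - i) = f (q ^ i) * of_real (qexp_coeff i * qprod_coeff (l - i)) * of_real (y ^ l)"
      if "i \<le> l" for i
    proof -
      have "y ^ l = y ^ i * y ^ (l - i)" using that by (simp flip: power_add)
      then show ?thesis by (simp add: a_def b_def)
    qed
    then show "(\<Sum>i\<le>l. a i * b (l - i)) = durr_coeff f l * of_real (y ^ l)"
      unfolding durr_coeff_def sum_distrib_right by (intro sum.cong) auto
  qed
  finally show ?thesis by (simp only: y_def)
qed

text \<open>A Newton-type series with nodes 1, 1/q, 1/q^2, ...: the l-th product vanishes at the
  first l of them.\<close>

definition durr_series :: "(real \<Rightarrow> complex) \<Rightarrow> complex \<Rightarrow> complex"
  where "durr_series f z = (\<Sum>l. durr_coeff f l * of_real (q ^ l) * qpoch z q l)"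

lemma qpoch_of_real: "qpoch (of_real x) q n = of_real (qpoch x q n)"
  by (simp add: qpoch_def)

lemma qpoch_1: "qpoch 1 q (Suc n) = 0"
  unfolding qpoch_def by (subst prod.lessThan_Suc_shift) simp

text \<open>At x = 1 only the term l = 0 survives and D_0 = f(1), matching the separate definition
  there. For x < 1 the series for A_k is inserted, the sums are interchanged, and the sum over k is
  evaluated by Euler's first series.\<close>

lemma limit_q_durrmeyer_eq_durr_series:
  assumes B: "\<And>i. norm (f (q ^ i)) \<le> B" and x: "x \<in> {0..1}"
  shows "limit_q_durrmeyer q f x = durr_series f (of_real x)"
proof (cases "x = 1")
  case True
  have "durr_series f 1 = (\<Sum>l\<in>{0}. durr_coeff f l * of_real (q ^ l) * qpoch 1 q l)"
    unfolding durr_series_def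
  proof (rule suminf_finite)
    show "durr_coeff f l * of_real (q ^ l) * qpoch 1 q l = 0" if "l \<notin> {0}" for l
      using that by (cases l) (simp_all add: qpoch_1)
  qed simp
  then show ?thesis using True by (simp add: limit_q_durrmeyer_def durr_coeff_def)
next
  case False
  then have x: "0 \<le> x" "x < 1" using assms by auto
  obtain C where C: "\<And>l. norm (durr_coeff f l) \<le> C" using durr_coeff_bounded[of f, OF B] by blast
  have C0: "0 \<le> C" using order_trans[OF norm_ge_zero C[of 0]] .
  define p where "p k = p_inf q k x" for k
  have p: "p k = qpoch_inf x q * (qexp_coeff k * x ^ k)" for k
    by (simp add: p_def p_inf_def qexp_coeff_def)
  have ps: "summable (\<lambda>k. norm (p k))"
    using summable_qexp_series[of x] x unfolding p by (auto simp: abs_mult intro!: summable_mult)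
  define T where "T k l = durr_coeff f l * of_real ((q ^ Suc k) ^ l) * of_real (p k)" for k l
  \<comment> \<open>Discarding the dependence on k in this power yields a majorant of
    \<open>T k l\<close> in product form, as the interchange requires.\<close>
  have "(q ^ Suc k) ^ l \<le> q ^ l" for k l
    using q power_le_one[of q k] by (intro power_mono) (auto simp: mult_left_le)
  then have T: "norm (T k l) \<le> norm (p k) * (C * q ^ l)" for k l
  proof -
    have "norm (T k l) = norm (durr_coeff f l) * (q ^ Suc k) ^ l * norm (p k)"
      using q by (simp add: T_def norm_mult norm_power)
    also have "\<dots> \<le> (C * q ^ l) * norm (p k)"
      using C[of l] C0 q \<open>(q ^ Suc k) ^ l \<le> q ^ l\<close>
      by (intro mult_right_mono mult_mono) auto
    finally show ?thesis by (simp add: mult.commute)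
  qed
  have Cq: "summable (\<lambda>l. C * q ^ l)" using q by (intro summable_mult summable_geometric) auto
  have "limit_q_durrmeyer q f x = (\<Sum>k. A_inf q k f * of_real (p k))"
    using False by (simp add: limit_q_durrmeyer_def p_def)
  also have "\<dots> = (\<Sum>k. \<Sum>l. T k l)"
  proof (rule suminf_cong)
    fix k
    have "summable (\<lambda>l. durr_coeff f l * of_real ((q ^ Suc k) ^ l))"
    proof (rule summable_comparison_test'[OF Cq])
      show "norm (durr_coeff f l * of_real ((q ^ Suc k) ^ l)) \<le> C * q ^ l" for l
        using C[of l] C0 q \<open>(q ^ Suc k) ^ l \<le> q ^ l\<close>
        by (simp only: norm_mult norm_of_real, intro mult_mono) auto
    qed
    then show "A_inf q k f * of_real (p k) = (\<Sum>l. T k l)"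
      unfolding A_inf_eq_suminf[of f, OF B] T_def by (rule suminf_mult2)
  qed
  also have "\<dots> = (\<Sum>l. \<Sum>k. T k l)"
    by (rule suminf_swap_dominated[OF ps _ Cq _ T]) (use C0 q in auto)
  also have "\<dots> = durr_series f (of_real x)"
    unfolding durr_series_def
  proof (rule suminf_cong)
    fix l
    \<comment> \<open>The factor q^(k l) in \<open>T k l\<close> merges with x^k into w^k.\<close>
    define w where "w = x * q ^ l"
    have w: "\<bar>w\<bar> < 1"
      using x q power_le_one[of q l] mult_left_le[of "q ^ l" x] by (simp add: w_def abs_mult)
    have sw: "summable (\<lambda>k. qexp_coeff k * w ^ k)"
      using summable_qexp_series[OF w] by (rule summable_norm_cancel)
    have "T k l = durr_coeff f l * of_real (q ^ l) * of_real (qpoch_inf x q) * of_real (qexp_coeff k * w ^ k)" for k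
      by (simp add: T_def p w_def power_mult_distrib mult_ac flip: power_mult)
    then have "(\<Sum>k. T k l) = durr_coeff f l * of_real (q ^ l) * of_real (qpoch_inf x q) *
        of_real (\<Sum>k. qexp_coeff k * w ^ k)"
      by (simp only: suminf_mult[OF summable_of_real[OF sw]] suminf_of_real[OF sw])
    \<comment> \<open>The factor (w;q)_inf cancels the Euler series at w, leaving (x;q)_l.\<close>
    also have "qpoch_inf x q = qpoch x q l * qpoch_inf w q"
      using qpoch_inf_split[of x l] by (simp add: w_def)
    finally show "(\<Sum>k. T k l) = durr_coeff f l * of_real (q ^ l) * qpoch (of_real x) q l"
      using arg_cong[OF euler_qexp_series[OF w], of complex_of_real]
      by (simp add: qpoch_of_real)
  qed
  finally show ?thesis .
qed

text \<open>Weierstrass M-test on the unit disc around each point x: there |(z;q)_l| <= (-r;q)_inf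
  with r = |x| + 1, and the factors q^l give convergence.\<close>

lemma durr_series_holomorphic:
  assumes C: "\<And>l. norm (durr_coeff f l) \<le> C"
  shows "durr_series f holomorphic_on UNIV"
proof (rule holomorphic_uniform_sequence[OF open_UNIV])
  let ?T = "\<lambda>l z. durr_coeff f l * of_real (q ^ l) * qpoch z q l"
  show "(\<lambda>z. \<Sum>l<n. ?T l z) holomorphic_on UNIV" for n
    unfolding qpoch_def by (intro holomorphic_intros)
  fix x :: complex
  define r where "r = norm x + 1"
  have "norm (?T l z) \<le> C * q ^ l * qpoch_inf (- r) q" if "z \<in> cball x 1" for l z
  proof -
    have "norm z \<le> r"
      using that norm_triangle_ineq2[of z x] by (simp add: r_def dist_norm norm_minus_commute)
    then have "norm (qpoch z q l) \<le> qpoch_inf (- r) q"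
      using norm_qpoch_le[of z r l] qpoch_neg_le_qpoch_inf[of r l] by (simp add: r_def)
    moreover have "0 \<le> C" using order_trans[OF norm_ge_zero C[of 0]] .
    ultimately show ?thesis using C[of l] q
      by (simp only: norm_mult norm_of_real, intro mult_mono) auto
  qed
  moreover have "summable (\<lambda>l. C * q ^ l * qpoch_inf (- r) q)"
    using q by (intro summable_mult2 summable_mult summable_geometric) auto
  ultimately have "uniform_limit (cball x 1) (\<lambda>n z. \<Sum>l<n. ?T l z) (durr_series f) sequentially"
    unfolding durr_series_def[abs_def] by (rule Weierstrass_m_test)
  then show "\<exists>d. 0 < d \<and> cball x d \<subseteq> UNIV \<and>
      uniform_limit (cball x d) (\<lambda>n z. \<Sum>l<n. ?T l z) (durr_series f) sequentially"
    by (intro exI[of _ 1]) auto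
qed

text \<open>Uniqueness comes from the identity theorem: two entire functions agreeing on [0,1] agree
  on a set that accumulates at 0.\<close>

lemma limit_q_durrmeyer_entire_eq:
  assumes B: "\<And>i. norm (f (q ^ i)) \<le> B"
  shows "limit_q_durrmeyer_entire q f = durr_series f"
  unfolding limit_q_durrmeyer_entire_def
proof (rule the_equality)
  obtain C where C: "\<And>l. norm (durr_coeff f l) \<le> C" using durr_coeff_bounded[of f, OF B] by blast
  note hol = durr_series_holomorphic[OF C]
  note eq = limit_q_durrmeyer_eq_durr_series[of f, OF B]
  show "durr_series f holomorphic_on UNIV \<and>
      (\<forall>x\<in>{0..1}. durr_series f (of_real x) = limit_q_durrmeyer q f x)"
    using hol eq by auto
  fix F assume F: "F holomorphic_on UNIV \<and> (\<forall>x\<in>{0..1}. F (of_real x) = limit_q_durrmeyer q f x)"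
  have lim: "(0::complex) islimpt complex_of_real ` {0..1}"
    unfolding islimpt_approachable
  proof (intro allI impI)
    fix e :: real assume "0 < e"
    then show "\<exists>x'\<in>complex_of_real ` {0..1}. x' \<noteq> 0 \<and> dist x' 0 < e"
      by (intro bexI[of _ "of_real (min 1 (e/2))"]) (auto simp: min_def)
  qed
  have "F z - durr_series f z = 0" for z
  proof (rule analytic_continuation[where f = "\<lambda>z. F z - durr_series f z" and S = UNIV and U = "complex_of_real ` {0..1}" and \<xi> = 0])
    show "(\<lambda>z. F z - durr_series f z) holomorphic_on UNIV"
      using F hol by (intro holomorphic_on_diff) auto
    show "F z - durr_series f z = 0" if "z \<in> complex_of_real ` {0..1}" for z
      using that F eq by auto
  qed (use lim in auto)
  then show "F = durr_series f" by auto
qed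

section \<open>Growth of the series and decay of its coefficients\<close>

text \<open>
  Since \<open>(-r;q)\<^sub>l = (-r;q)\<^sub>\<infinity> / (-rq\<^sup>l;q)\<^sub>\<infinity>\<close>, the growth of the denominator gains a factor \<open>(rq\<^sup>l)\<^bsup>-\<mu>\<^esup>\<close>
  in the \<open>l\<close>-th term.
\<close>

lemma durr_series_growth:
  assumes \<mu>: "0 \<le> \<mu>" "\<mu> < 1 + real m" and C: "\<And>l. norm (durr_coeff f l) \<le> C * q ^ (m * l)"
  shows "\<exists>K. \<forall>r>0. \<forall>z\<in>cball 0 r. norm (durr_series f z) \<le> K * (r powr (- \<mu>) * qpoch_inf (- r) q)"
proof -
  obtain c where c: "0 < c" "\<And>s. 0 < s \<Longrightarrow> c * s powr \<mu> \<le> qpoch_inf (- s) q"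
    using qpoch_inf_neg_ge_powr[OF \<mu>(1)] by blast
  have C0: "0 \<le> C" using order_trans[OF norm_ge_zero C[of 0]] by simp
  \<comment> \<open>The l-th term carries q^(m l) from D_l, q^l from the series and q^(-l \<mu>)
    from the growth bound; together these are \<open>\<rho> ^ l\<close>, and \<mu> < 1 + m makes
    \<rho> < 1.\<close>
  define \<rho> where "\<rho> = q powr (1 + real m - \<mu>)"
  have \<rho>: "0 < \<rho>" "\<rho> < 1" using q \<mu> powr_less_mono'[of q 0 "1 + real m - \<mu>"] by (auto simp: \<rho>_def)
  have "norm (durr_series f z) \<le> (C / c * suminf (\<lambda>l. \<rho> ^ l)) * (r powr (- \<mu>) * qpoch_inf (- r) q)"
    if r: "0 < r" and z: "norm z \<le> r" for r z
  proof -
    define Q where "Q = qpoch_inf (- r) q"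
    have "norm (durr_coeff f l * of_real (q ^ l) * qpoch z q l)
       \<le> C / c * r powr (- \<mu>) * Q * \<rho> ^ l" for l
    proof -
      define P where "P = qpoch (- r) q l"
      have P: "0 < P" using qpoch_neg_ge_1[of r l] r by (simp add: P_def)
      have "Q = P * qpoch_inf (- (r * q ^ l)) q"
        using qpoch_inf_split[of "- r" l] by (simp add: Q_def P_def)
      then have "P * (c * (r * q ^ l) powr \<mu>) \<le> Q"
        using c(2)[of "r * q ^ l"] r q P by simp
      moreover have "(r * q ^ l) powr \<mu> = r powr \<mu> * q powr (l * \<mu>)"
        using r q by (simp add: powr_mult powr_powr flip: powr_realpow)
      ultimately have PQ: "P \<le> Q / c * r powr (- \<mu>) * q powr (- (l * \<mu>))"
        using r q c by (simp add: powr_minus field_simps)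
      have "norm (durr_coeff f l * of_real (q ^ l) * qpoch z q l) \<le> C * q ^ (m * l) * q ^ l * P"
        using norm_qpoch_le[OF z, of l] C[of l] C0 q P
        unfolding P_def by (simp only: norm_mult norm_of_real, intro mult_mono) auto
      also have "\<dots> \<le> C * q ^ (m * l) * q ^ l * (Q / c * r powr (- \<mu>) * q powr (- (l * \<mu>)))"
        using PQ C0 q by (intro mult_left_mono) auto
      also have "\<dots> = C / c * r powr (- \<mu>) * Q * (q ^ (m * l) * q ^ l * q powr (- (l * \<mu>)))"
        by (simp add: mult_ac)
      also have "q ^ (m * l) * q ^ l * q powr (- (l * \<mu>)) = \<rho> ^ l"
        using q by (simp add: \<rho>_def powr_powr powr_add[symmetric] algebra_simps flip: powr_realpow)
      finally show ?thesis .
    qed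
    moreover have s: "summable (\<lambda>l. C / c * r powr (- \<mu>) * Q * \<rho> ^ l)"
      using \<rho> by (intro summable_mult summable_geometric) auto
    ultimately have "norm (durr_series f z) \<le> (\<Sum>l. C / c * r powr (- \<mu>) * Q * \<rho> ^ l)"
      unfolding durr_series_def by (rule norm_suminf_le)
    also have "\<dots> = C / c * r powr (- \<mu>) * Q * (\<Sum>l. \<rho> ^ l)"
      using \<rho> by (intro suminf_mult summable_geometric) auto
    finally show ?thesis by (simp add: Q_def mult_ac)
  qed
  then show ?thesis by (intro exI[of _ "C / c * suminf (\<lambda>l. \<rho> ^ l)"]) auto
qed

text \<open>Subtracting the Taylor polynomial leaves a remainder \<open>h\<close> of size O(q^(m i))
  at the nodes, to which the flat case applies. The polynomial has degree below m, so it contributes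
  nothing to D_l for l >= m; the finitely many smaller l only enlarge the constant.\<close>

lemma durr_coeff_decay:
  assumes B: "\<And>i. norm (f (q ^ i)) \<le> B"
    and \<delta>: "0 < \<delta>" and R: "\<And>t. t \<in> {0..<\<delta>} \<Longrightarrow> norm (f t - (\<Sum>s<m. c s * of_real t ^ s)) \<le> K * t ^ m"
  shows "\<exists>C. \<forall>l. norm (durr_coeff f l) \<le> C * q ^ (m * l)"
proof -
  define h where "h t = f t - (\<Sum>s<m. c s * of_real t ^ s)" for t :: real
  have "(\<lambda>i. q ^ i) \<longlonglongrightarrow> 0" using q by (intro LIMSEQ_power_zero) auto
  then have "eventually (\<lambda>i. q ^ i < \<delta>) sequentially" using \<delta> by (rule order_tendstoD)
  then obtain N where N: "\<And>i. N \<le> i \<Longrightarrow> q ^ i < \<delta>" by (auto simp: eventually_sequentially)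
  \<comment> \<open>Nodes with i < N may lie outside [0, \<delta>); their finitely many quotients
    are added to the constant.\<close>
  define K' where "K' = \<bar>K\<bar> + (\<Sum>i<N. norm (h (q ^ i)) / q ^ (m * i))"
  have "norm (h (q ^ i)) \<le> K' * q ^ (m * i)" for i
  proof -
    have "norm (h (q ^ i)) / q ^ (m * i) \<le> K'"
    proof (cases "i < N")
      case True
      then have "norm (h (q ^ i)) / q ^ (m * i) \<le> (\<Sum>i<N. norm (h (q ^ i)) / q ^ (m * i))"
        using q by (intro member_le_sum) auto
      then show ?thesis by (simp add: K'_def)
    next
      case False
      then have "norm (h (q ^ i)) \<le> K * (q ^ i) ^ m"
        unfolding h_def using N[of i] q by (intro R) auto
      then have "norm (h (q ^ i)) / q ^ (m * i) \<le> K"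
        using q by (simp add: divide_simps mult.commute flip: power_mult)
      also have "K \<le> K'"
        unfolding K'_def using q by (intro add_increasing2 sum_nonneg) auto
      finally show ?thesis .
    qed
    then show ?thesis using q by (simp add: divide_simps)
  qed
  from durr_coeff_decay_of_flat[OF this] obtain C1 where
    C1: "\<And>l. norm (durr_coeff h l) \<le> C1 * q ^ (m * l)" by blast
  have same: "durr_coeff h l = durr_coeff f l" if "m \<le> l" for l
  proof -
    have "(\<Sum>s<m. c s * durr_coeff (\<lambda>t. of_real t ^ s) l) = 0"
      using that by (intro sum.neutral) (auto simp: durr_coeff_power_eq_0)
    then show ?thesis
      using durr_coeff_sum[of c "\<lambda>s t. of_real t ^ s" "{..<m}" l]
        durr_coeff_diff[of f "\<lambda>t. \<Sum>s<m. c s * of_real t ^ s" l]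
      by (simp add: h_def[abs_def])
  qed
  have "norm (durr_coeff f l) \<le> (\<bar>C1\<bar> + (\<Sum>l<m. norm (durr_coeff f l) / q ^ (m * l))) * q ^ (m * l)" for l
  proof -
    have "norm (durr_coeff f l) / q ^ (m * l) \<le> \<bar>C1\<bar> + (\<Sum>l<m. norm (durr_coeff f l) / q ^ (m * l))"
    proof (cases "l < m")
      case True
      then have "norm (durr_coeff f l) / q ^ (m * l) \<le> (\<Sum>l<m. norm (durr_coeff f l) / q ^ (m * l))"
        using q by (intro member_le_sum) auto
      then show ?thesis by simp
    next
      case False
      then have "norm (durr_coeff f l) / q ^ (m * l) \<le> C1"
        using C1[of l] same[of l] q by (simp add: divide_simps)
      also have "\<dots> \<le> \<bar>C1\<bar> + (\<Sum>l<m. norm (durr_coeff f l) / q ^ (m * l))"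
        using q by (intro add_increasing2 sum_nonneg) auto
      finally show ?thesis .
    qed
    then show ?thesis using q by (simp add: divide_simps)
  qed
  then show ?thesis by blast
qed

end

section \<open>From an O-bound with a larger exponent to the o-bound\<close>

theorem theorem2p9:
  fixes q lam :: real and m :: nat and f :: "real \<Rightarrow> complex"
  assumes "0 < q" and "q < 1"
    and "0 < m"
    and "continuous_on {0..1} f"
    and "times_differentiable_at_right m f 0"
    and "lam < 1 + real m"
  shows "(\<lambda>r. max_modulus r (limit_q_durrmeyer_entire q f))
           \<in> o[at_top](\<lambda>r. r powr (- lam) * qpoch_inf (- r) q)"
proof -
  note q = \<open>0 < q\<close> \<open>q < 1\<close>
  have "bounded (f ` {0..1})"
    using assms(4) by (intro compact_imp_bounded compact_continuous_image) auto
  then obtain B where "\<And>t. t \<in> {0..1} \<Longrightarrow> norm (f t) \<le> B"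
    unfolding bounded_iff by blast
  then have B: "norm (f (q ^ i)) \<le> B" for i using q by (simp add: power_le_one)
  obtain c K \<delta> where \<delta>: "0 < \<delta>" and
    R: "\<And>t. t \<in> {0..<\<delta>} \<Longrightarrow> norm (f t - (\<Sum>s<m. c s * of_real t ^ s)) \<le> K * t ^ m"
    using taylor_right_remainder[OF assms(5,3)] unfolding add_0 by blast
  obtain C where C: "\<And>l. norm (durr_coeff q f l) \<le> C * q ^ (m * l)"
    using durr_coeff_decay[OF q, of f, OF B \<delta> R] by blast
  \<comment> \<open>The midpoint of max(lam, 0) and 1 + m is admissible in the growth bound, and it
    exceeds \<open>lam\<close>, so the gap in exponents turns O into o.\<close>
  define \<mu> where "\<mu> = (max lam 0 + (1 + real m)) / 2"
  have \<mu>: "0 \<le> \<mu>" "\<mu> < 1 + real m" "lam < \<mu>" using assms(6) by (auto simp: \<mu>_def max_def)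
  define F where "F = limit_q_durrmeyer_entire q f"
  have F: "F = durr_series q f" unfolding F_def by (rule limit_q_durrmeyer_entire_eq[OF q, of f, OF B])
  obtain K where K: "\<And>r z. 0 < r \<Longrightarrow> z \<in> cball 0 r \<Longrightarrow>
      norm (F z) \<le> K * (r powr (- \<mu>) * qpoch_inf (- r) q)"
    using durr_series_growth[OF q \<mu>(1,2) C] unfolding F by blast
  have "norm (max_modulus r F) \<le> K * norm (r powr (- \<mu>) * qpoch_inf (- r) q)" if r: "0 < r" for r
  proof -
    have "max_modulus r F \<le> K * (r powr (- \<mu>) * qpoch_inf (- r) q)"
      unfolding max_modulus_def using K[OF r] r by (intro cSUP_least) auto
    \<comment> \<open>The pointwise bound also supplies the boundedness needed to compare the
      supremum with the value at 0.\<close>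
    moreover have "0 \<le> max_modulus r F"
      unfolding max_modulus_def
      using K[OF r] r by (intro cSUP_upper2[where x = 0] bdd_aboveI2) auto
    moreover have "0 \<le> qpoch_inf (- r) q" using qpoch_inf_neg_ge_1[OF q, of r] r by simp
    ultimately show ?thesis by simp
  qed
  then have "(\<lambda>r. max_modulus r F) \<in> O[at_top](\<lambda>r. r powr (- \<mu>) * qpoch_inf (- r) q)"
    by (intro bigoI eventually_mono[OF eventually_gt_at_top[of 0]]) auto
  moreover have "(\<lambda>r. r powr (- \<mu>)) \<in> o[at_top](\<lambda>r::real. r powr (- lam))"
    using \<mu> by (intro powr_smallo_iff[THEN iffD2] filterlim_ident) auto
  then have "(\<lambda>r. r powr (- \<mu>) * qpoch_inf (- r) q) \<in> o[at_top](\<lambda>r. r powr (- lam) * qpoch_inf (- r) q)"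
    by (rule landau_o.small_big_mult) simp
  ultimately show ?thesis unfolding F_def by (rule landau_o.big_small_trans)
qed

end
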